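(* Let $f$ be a function on $\partial V$ and let $a=(a_{ij})_{n\times n}$ be a measurement matrix. Then $v\in\mathcal{V}_{(f,a)}$ if and only if $v$ is a minimizer of the least gradient problem $$\min\Big\{\tfrac12\sum_{i,j}a_{ij}|u_i-u_j| \;:\; u\in\mathbb{R}^n,\ u|_{\partial V}=f\Big\}.$$
   Context: $G=(V,E)$ is a simple, undirected, connected graph with vertex set $V=\{1,\dots,n\}$; $\partial V\subset V$ is a nonempty set of boundary vertices and $\mathrm{int}(V)=V\setminus\partial V$. A measurement matrix is a symmetric $n\times n$ matrix $a=(a_{ij})$ with $a_{ij}\in[0,\infty)$ for all $1\le i,j\le n$ and $a_{ij}=0$ whenever $i=j$ or $\{i,j\}\notin E$. A current is a real $n\times n$ matrix $J=(J_{ij})$ with $J_{ij}=-J_{ji}$, $J_{ii}=0$, and $J_{ij}=0$ whenever $\{i,j\}\notin E$. Given $f:\partial V\to\mathbb{R}$ and a measurement matrix $a$, a symmetric matrix $\sigma=(\sigma_{ij})_{n\times n}$ with $\sigma_{ij}\in[0,\infty]$ is a conductivity matrix associated to the data $(f,a)$ if there exist a function $v:\{1,\dots,n\}\to\mathbb{R}$ with $v|_{\partial V}=f$ and a current $J=(J_{ij})$ such that $$J_{ij}=\sigma_{ij}(v_i-v_j)\ \text{ and }\ |J_{ij}|=a_{ij}\quad\text{for all } i,j \text{ with } v_i\neq v_j,$$ and $\sum_{j=1}^n J_{ij}=0$ for all $i\in\mathrm{int}(V)$. When $a_{ij}\ne0$ and $v_i=v_j$, one formally sets $\sigma_{ij}=\infty$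 and says that the edge between $i$ and $j$ is a perfect conductor. Such a function $v$ is called a voltage potential, and $\mathcal{V}_{(f,a)}$ denotes the set of all voltage potentials corresponding to the data $(f,a)$.
   Formalization: The definition of voltage potential additionally requires |J_ij| ≤ a_ij whenever v_i = v_j; without this bound on currents between equal potentials the claim fails (path 1-2-3, f(1)=0, f(3)=1, a_12=1, a_23=2, v=(0,0,1)). *)

theory Defs
  imports "HOL-Analysis.Analysis"
begin

text \<open>
  The vertex set is the finite index type of the matrices, so that vectors over it are
  \<open>real ^ 'n\<close>; \<open>E\<close> is the set of undirected edges and \<open>B\<close> the set of boundary vertices.
\<close>

definition simple_graph :: "'n set set \<Rightarrow> bool" where
  "simple_graph E \<longleftrightarrow> (\<forall>e\<in>E. card e = 2)"

definition connected_graph :: "'n set set \<Rightarrow> bool" where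
  "connected_graph E \<longleftrightarrow> (\<forall>i j. (i, j) \<in> {(x, y). {x, y} \<in> E}\<^sup>*)"

definition measurement_matrix :: "'n::finite set set \<Rightarrow> real ^ 'n ^ 'n \<Rightarrow> bool" where
  "measurement_matrix E a \<longleftrightarrow>
     transpose a = a \<and> (\<forall>i j. 0 \<le> a $ i $ j) \<and>
     (\<forall>i j. i = j \<or> {i, j} \<notin> E \<longrightarrow> a $ i $ j = 0)"

definition current :: "'n::finite set set \<Rightarrow> real ^ 'n ^ 'n \<Rightarrow> bool" where
  "current E J \<longleftrightarrow>
     (\<forall>i j. J $ i $ j = - J $ j $ i) \<and> (\<forall>i. J $ i $ i = 0) \<and>
     (\<forall>i j. {i, j} \<notin> E \<longrightarrow> J $ i $ j = 0)"

text \<open>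
  Boundary data is a total function of which only the values on \<open>B\<close> are used.
\<close>

definition agrees_on_boundary :: "'n::finite set \<Rightarrow> ('n \<Rightarrow> real) \<Rightarrow> real ^ 'n \<Rightarrow> bool" where
  "agrees_on_boundary B f u \<longleftrightarrow> (\<forall>i\<in>B. u $ i = f i)"

text \<open>
  \<open>J\<close> is a current driven by the potential \<open>v\<close> through the conductivities \<open>\<sigma>\<close>. The first law
  is an equation between extended reals; as \<open>J $ i $ j\<close> is finite, it forces
  \<open>\<sigma> $ i $ j\<close> to be finite whenever \<open>v $ i \<noteq> v $ j\<close>.

  Where \<open>v $ i = v $ j\<close>, Ohm's law says nothing about \<open>J $ i $ j\<close>. There the measured value is
  read as a capacity, \<open>\<bar>J $ i $ j\<bar> \<le> a $ i $ j\<close>, as is customary for perfect conductors; an edge with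
  \<open>a $ i $ j = 0\<close> then carries no current. This convention cannot be dropped: with arbitrary
  currents between equipotential vertices, on the path 1 - 2 - 3 with boundary values
  \<open>f 1 = 0\<close>, \<open>f 3 = 1\<close> and measurements 1 on the edge 12 and 2 on the edge 23, the
  vector \<open>(0, 0, 1)\<close>, which is not a minimizer, would count as a voltage potential.
\<close>

definition drives_current ::
  "'n::finite set set \<Rightarrow> 'n set \<Rightarrow> real ^ 'n ^ 'n \<Rightarrow> ereal ^ 'n ^ 'n \<Rightarrow> real ^ 'n \<Rightarrow> real ^ 'n ^ 'n \<Rightarrow> bool"
  where
  "drives_current E B a \<sigma> v J \<longleftrightarrow>
     current E J \<and>
     (\<forall>i j. v $ i \<noteq> v $ j \<longrightarrow>
        ereal (J $ i $ j) = \<sigma> $ i $ j * ereal (v $ i - v $ j) \<and> \<bar>J $ i $ j\<bar> = a $ i $ j) \<and>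
     (\<forall>i j. v $ i = v $ j \<longrightarrow> \<bar>J $ i $ j\<bar> \<le> a $ i $ j) \<and>
     (\<forall>i j. v $ i = v $ j \<and> a $ i $ j \<noteq> 0 \<longrightarrow> \<sigma> $ i $ j = \<infinity>) \<and>
     (\<forall>i. i \<notin> B \<longrightarrow> (\<Sum>j\<in>UNIV. J $ i $ j) = 0)"

definition voltage_potential_for ::
  "'n::finite set set \<Rightarrow> 'n set \<Rightarrow> ('n \<Rightarrow> real) \<Rightarrow> real ^ 'n ^ 'n \<Rightarrow> ereal ^ 'n ^ 'n \<Rightarrow> real ^ 'n \<Rightarrow> bool"
  where
  "voltage_potential_for E B f a \<sigma> v \<longleftrightarrow>
     agrees_on_boundary B f v \<and> (\<exists>J. drives_current E B a \<sigma> v J)"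

definition conductivity_matrix ::
  "'n::finite set set \<Rightarrow> 'n set \<Rightarrow> ('n \<Rightarrow> real) \<Rightarrow> real ^ 'n ^ 'n \<Rightarrow> ereal ^ 'n ^ 'n \<Rightarrow> bool"
  where
  "conductivity_matrix E B f a \<sigma> \<longleftrightarrow>
     transpose \<sigma> = \<sigma> \<and> (\<forall>i j. 0 \<le> \<sigma> $ i $ j) \<and>
     (\<exists>v. voltage_potential_for E B f a \<sigma> v)"

definition voltage_potentials ::
  "'n::finite set set \<Rightarrow> 'n set \<Rightarrow> ('n \<Rightarrow> real) \<Rightarrow> real ^ 'n ^ 'n \<Rightarrow> (real ^ 'n) set"
  where
  "voltage_potentials E B f a =
     {v. \<exists>\<sigma>. conductivity_matrix E B f a \<sigma> \<and> voltage_potential_for E B f a \<sigma> v}"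

end

theory Submission
  imports Defs
begin

text \<open>
  The least gradient functional is convex and piecewise linear, and its optimality condition is
  the discrete form of the calibration argument. A flow \<open>J\<close> with \<open>\<bar>J i j\<bar> \<le> a i j\<close> satisfies
  \<open>J i j * (u i - u j) \<le> a i j * \<bar>u i - u j\<bar>\<close> for every \<open>u\<close>; it calibrates \<open>v\<close> when equality holds
  at \<open>u = v\<close>. The conductivities can be eliminated from the notion of voltage potential: what
  remains is that \<open>v\<close> has the right boundary values and is calibrated by a flow conserved at the
  interior vertices (\<open>voltage_potentials_iff_calibrated\<close>).

  Summation by parts shows that the total pairing of a conserved flow with the gradient of \<open>u\<close>
  depends only on the boundary values of \<open>u\<close>, so that a calibrated \<open>v\<close> is a minimizer
  (\<open>calibrated_imp_minimizer\<close>).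

  Conversely, the flows calibrating \<open>v\<close> form a compact convex set, and so do their
  divergences at the interior vertices. If these divergences miss \<open>0\<close>, a
  separating hyperplane provides a direction \<open>h\<close>, vanishing on the boundary, that pairs
  positively with all calibrating flows. The flow that is least favourable for \<open>h\<close> determines the
  one-sided derivative of the functional at \<open>v\<close> along \<open>-h\<close>, which is therefore negative, and
  \<open>v\<close> is not a minimizer (\<open>minimizer_imp_calibrated\<close>).
\<close>

section \<open>Summation by parts\<close>

definition antisymmetric :: "real ^ 'n ^ 'n \<Rightarrow> bool" where
  "antisymmetric J \<longleftrightarrow> (\<forall>i j. J $ i $ j = - J $ j $ i)"

lemma sum_by_parts:
  fixes J :: "real ^ 'n::finite ^ 'n" and u :: "real ^ 'n"
  assumes "antisymmetric J"
  shows "(\<Sum>i\<in>UNIV. \<Sum>j\<in>UNIV. J $ i $ j * (u $ i - u $ j)) =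
    2 * (\<Sum>i\<in>UNIV. u $ i * (\<Sum>j\<in>UNIV. J $ i $ j))"
proof -
  have "(\<Sum>i\<in>UNIV. \<Sum>j\<in>UNIV. J $ i $ j * u $ j) = (\<Sum>j\<in>UNIV. \<Sum>i\<in>UNIV. J $ i $ j * u $ j)"
    by (rule sum.swap)
  also have "\<dots> = (\<Sum>j\<in>UNIV. \<Sum>i\<in>UNIV. - (u $ j * J $ j $ i))"
    using assms unfolding antisymmetric_def
    by (intro sum.cong refl) (metis mult.commute mult_minus_right)
  also have "\<dots> = - (\<Sum>j\<in>UNIV. u $ j * (\<Sum>i\<in>UNIV. J $ j $ i))"
    by (simp add: sum_negf sum_distrib_left)
  finally show ?thesis
    by (simp add: right_diff_distrib sum_subtractf sum_distrib_left mult.commute)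
qed

definition conserved_off :: "'n::finite set \<Rightarrow> real ^ 'n ^ 'n \<Rightarrow> bool" where
  "conserved_off B J \<longleftrightarrow> (\<forall>i. i \<notin> B \<longrightarrow> (\<Sum>j\<in>UNIV. J $ i $ j) = 0)"

text \<open>
  After summation by parts an interior vertex contributes nothing, because the flow has no
  divergence there.
\<close>
lemma pairing_depends_on_boundary:
  fixes J :: "real ^ 'n::finite ^ 'n"
  assumes "antisymmetric J" and "conserved_off B J"
    and "agrees_on_boundary B f u" and "agrees_on_boundary B f w"
  shows "(\<Sum>i\<in>UNIV. \<Sum>j\<in>UNIV. J $ i $ j * (u $ i - u $ j)) =
    (\<Sum>i\<in>UNIV. \<Sum>j\<in>UNIV. J $ i $ j * (w $ i - w $ j))"
proof -
  have "u $ i * (\<Sum>j\<in>UNIV. J $ i $ j) = w $ i * (\<Sum>j\<in>UNIV. J $ i $ j)" for i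
    using assms by (cases "i \<in> B") (auto simp: conserved_off_def agrees_on_boundary_def)
  then show ?thesis
    by (simp only: sum_by_parts[OF assms(1)])
qed

section \<open>Calibrating flows\<close>

definition calibrations :: "real ^ 'n ^ 'n \<Rightarrow> real ^ 'n \<Rightarrow> (real ^ 'n::finite ^ 'n) set" where
  "calibrations a v = {J. antisymmetric J \<and>
     (\<forall>i j. \<bar>J $ i $ j\<bar> \<le> a $ i $ j \<and> J $ i $ j * (v $ i - v $ j) = a $ i $ j * \<bar>v $ i - v $ j\<bar>)}"

lemma calibrations_value:
  assumes "J \<in> calibrations a v" and "v $ i \<noteq> v $ j"
  shows "J $ i $ j = a $ i $ j * sgn (v $ i - v $ j)"
proof -
  have "J $ i $ j * (v $ i - v $ j) = (a $ i $ j * sgn (v $ i - v $ j)) * (v $ i - v $ j)"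
    using assms(1) by (auto simp: calibrations_def sgn_real_def)
  then show ?thesis using assms(2) by simp
qed

lemma convex_calibrations: "convex (calibrations a v)"
proof (rule convexI)
  fix J K :: "real ^ 'a ^ 'a" and s t :: real
  assume J: "J \<in> calibrations a v" and K: "K \<in> calibrations a v"
    and st: "0 \<le> s" "0 \<le> t" "s + t = 1"
  have "\<bar>s * J $ i $ j + t * K $ i $ j\<bar> \<le> a $ i $ j" for i j
  proof -
    have "J $ i $ j \<in> {- a $ i $ j .. a $ i $ j}" "K $ i $ j \<in> {- a $ i $ j .. a $ i $ j}"
      using J K unfolding calibrations_def by (auto simp: abs_le_iff minus_le_iff)
    then have "s *\<^sub>R J $ i $ j + t *\<^sub>R K $ i $ j \<in> {- a $ i $ j .. a $ i $ j}"
      using st by (intro convexD convex_real_interval)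
    then show ?thesis by (auto simp: abs_le_iff)
  qed
  moreover have "(s * J $ i $ j + t * K $ i $ j) * (v $ i - v $ j) = a $ i $ j * \<bar>v $ i - v $ j\<bar>" for i j
  proof -
    have "(s * J $ i $ j + t * K $ i $ j) * (v $ i - v $ j) =
        s * (J $ i $ j * (v $ i - v $ j)) + t * (K $ i $ j * (v $ i - v $ j))"
      by (simp add: algebra_simps)
    also have "\<dots> = (s + t) * (a $ i $ j * \<bar>v $ i - v $ j\<bar>)"
      using J K unfolding calibrations_def by (simp add: distrib_right)
    finally show ?thesis using st by simp
  qed
  moreover have "antisymmetric (s *\<^sub>R J + t *\<^sub>R K)"
    unfolding antisymmetric_def
  proof (intro allI)
    fix i j
    have "J $ i $ j = - J $ j $ i" "K $ i $ j = - K $ j $ i"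
      using J K unfolding calibrations_def antisymmetric_def by blast+
    then show "(s *\<^sub>R J + t *\<^sub>R K) $ i $ j = - (s *\<^sub>R J + t *\<^sub>R K) $ j $ i" by simp
  qed
  ultimately show "s *\<^sub>R J + t *\<^sub>R K \<in> calibrations a v"
    by (simp add: calibrations_def)
qed

lemma compact_calibrations: "compact (calibrations a v)"
proof -
  have "calibrations a v \<subseteq> cbox (- a) a"
    by (auto simp: calibrations_def mem_box Basis_vec_def inner_axis abs_le_iff minus_le_iff)
  moreover have "closed (calibrations a v)"
    unfolding calibrations_def antisymmetric_def
    by (intro closed_Collect_conj closed_Collect_all closed_Collect_eq closed_Collect_le
        continuous_intros)
  ultimately show ?thesis
    using bounded_cbox bounded_subset compact_eq_bounded_closed by blast
qed

text \<open>
  Where the potential jumps, a nonnegative conductivity exists exactly when the current runs from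
  the higher to the lower potential; together with the magnitude \<open>a i j\<close> this is what the calibration
  identity says, and the conductivity is then \<open>a i j / \<bar>v i - v j\<bar>\<close>. Between equal potentials the
  calibration identity is void, and only the capacity bound remains on both sides.
\<close>
lemma voltage_potentials_iff_calibrated:
  assumes a: "measurement_matrix E a"
  shows "v \<in> voltage_potentials E B f a \<longleftrightarrow>
    agrees_on_boundary B f v \<and> (\<exists>J\<in>calibrations a v. conserved_off B J)"
proof
  assume "v \<in> voltage_potentials E B f a"
  then obtain \<sigma> J where nn: "\<forall>i j. 0 \<le> \<sigma> $ i $ j" and v: "agrees_on_boundary B f v"
    and J: "drives_current E B a \<sigma> v J"
    by (auto simp: voltage_potentials_def conductivity_matrix_def voltage_potential_for_def)
  have "\<bar>J $ i $ j\<bar> \<le> a $ i $ j \<and> J $ i $ j * (v $ i - v $ j) = a $ i $ j * \<bar>v $ i - v $ j\<bar>" for i j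
  proof (cases "v $ i = v $ j")
    case True
    then show ?thesis using J by (simp add: drives_current_def)
  next
    case False
    then have ohm: "ereal (J $ i $ j) = \<sigma> $ i $ j * ereal (v $ i - v $ j)"
      and abs: "\<bar>J $ i $ j\<bar> = a $ i $ j"
      using J by (auto simp: drives_current_def)
    have "0 \<le> \<sigma> $ i $ j" using nn by blast
    then have "0 \<le> J $ i $ j * (v $ i - v $ j)"
      using ohm False by (cases "\<sigma> $ i $ j") (auto simp: mult.assoc split: if_splits)
    then have "J $ i $ j * (v $ i - v $ j) = \<bar>J $ i $ j\<bar> * \<bar>v $ i - v $ j\<bar>"
      by (metis abs_mult abs_of_nonneg)
    then show ?thesis using abs by simp
  qed
  moreover have "antisymmetric J"
    using J unfolding antisymmetric_def drives_current_def current_def by blast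
  ultimately have "J \<in> calibrations a v"
    by (simp add: calibrations_def)
  moreover have "conserved_off B J"
    using J by (simp add: drives_current_def conserved_off_def)
  ultimately show "agrees_on_boundary B f v \<and> (\<exists>J\<in>calibrations a v. conserved_off B J)"
    using v by blast
next
  assume "agrees_on_boundary B f v \<and> (\<exists>J\<in>calibrations a v. conserved_off B J)"
  then obtain J where v: "agrees_on_boundary B f v" and J: "J \<in> calibrations a v"
    and cons: "conserved_off B J" by blast
  have sym: "a $ i $ j = a $ j $ i" and a0: "0 \<le> a $ i $ j"
    and supp: "i = j \<or> {i, j} \<notin> E \<Longrightarrow> a $ i $ j = 0" for i j
    using a by (auto simp: measurement_matrix_def transpose_def vec_eq_iff)
  define \<sigma> :: "ereal ^ 'a ^ 'a" where
    "\<sigma> = (\<chi> i j. if v $ i \<noteq> v $ j then ereal (a $ i $ j / \<bar>v $ i - v $ j\<bar>)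
                  else if a $ i $ j = 0 then 0 else \<infinity>)"
  have le: "\<bar>J $ i $ j\<bar> \<le> a $ i $ j" for i j
    using J by (simp add: calibrations_def)
  have J0: "J $ i $ j = 0" if "i = j \<or> {i, j} \<notin> E" for i j
    using le[of i j] supp[OF that] by simp
  have "current E J"
    using J J0 unfolding current_def calibrations_def antisymmetric_def by blast
  moreover have "ereal (J $ i $ j) = \<sigma> $ i $ j * ereal (v $ i - v $ j) \<and> \<bar>J $ i $ j\<bar> = a $ i $ j"
    if "v $ i \<noteq> v $ j" for i j
    using that a0[of i j]
    by (simp add: \<sigma>_def calibrations_value[OF J that] abs_mult abs_sgn_eq sgn_real_def field_simps)
  moreover have "\<sigma> $ i $ j = \<infinity>" if "v $ i = v $ j" "a $ i $ j \<noteq> 0" for i j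
    using that by (simp add: \<sigma>_def)
  ultimately have "drives_current E B a \<sigma> v J"
    using le cons by (simp add: drives_current_def conserved_off_def)
  then have pot: "voltage_potential_for E B f a \<sigma> v"
    using v by (auto simp: voltage_potential_for_def)
  have "transpose \<sigma> = \<sigma>"
    using sym by (auto simp: transpose_def \<sigma>_def vec_eq_iff abs_minus_commute)
  moreover have "0 \<le> \<sigma> $ i $ j" for i j
    using a0[of i j] by (simp add: \<sigma>_def)
  ultimately show "v \<in> voltage_potentials E B f a"
    using pot by (auto simp: voltage_potentials_def conductivity_matrix_def)
qed

section \<open>Calibration as optimality condition\<close>

text \<open>
  Every edge is counted in both orientations, so this is twice the objective of the least
  gradient problem.
\<close>
definition total_variation :: "real ^ 'n ^ 'n \<Rightarrow> real ^ 'n::finite \<Rightarrow> real" where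
  "total_variation a u = (\<Sum>i\<in>UNIV. \<Sum>j\<in>UNIV. a $ i $ j * \<bar>u $ i - u $ j\<bar>)"

text \<open>
  The pairing with a calibrating flow is a lower bound for the total variation that is attained
  at \<open>v\<close> and, by conservation, is the same for all competitors.
\<close>
lemma calibrated_imp_minimizer:
  assumes J: "J \<in> calibrations a v" and cons: "conserved_off B J"
    and v: "agrees_on_boundary B f v" and u: "agrees_on_boundary B f u"
  shows "total_variation a v \<le> total_variation a u"
proof -
  have "total_variation a v = (\<Sum>i\<in>UNIV. \<Sum>j\<in>UNIV. J $ i $ j * (v $ i - v $ j))"
    using J by (simp add: total_variation_def calibrations_def)
  also have "\<dots> = (\<Sum>i\<in>UNIV. \<Sum>j\<in>UNIV. J $ i $ j * (u $ i - u $ j))"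
    using J cons v u by (intro pairing_depends_on_boundary) (auto simp: calibrations_def)
  also have "\<dots> \<le> total_variation a u"
    unfolding total_variation_def
  proof (intro sum_mono)
    fix i j
    have "J $ i $ j * (u $ i - u $ j) \<le> \<bar>J $ i $ j\<bar> * \<bar>u $ i - u $ j\<bar>"
      by (metis abs_ge_self abs_mult)
    also have "\<dots> \<le> a $ i $ j * \<bar>u $ i - u $ j\<bar>"
      using J by (intro mult_right_mono) (auto simp: calibrations_def)
    finally show "J $ i $ j * (u $ i - u $ j) \<le> a $ i $ j * \<bar>u $ i - u $ j\<bar>" .
  qed
  finally show ?thesis .
qed

text \<open>
  Where \<open>v\<close> jumps, a calibrating flow is determined, and where it does not, any
  antisymmetric choice between \<open>-a\<close> and \<open>a\<close> is allowed; taking it opposite to the gradient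
  of \<open>h\<close> makes its pairing with that gradient as small as possible. As the functional is piecewise linear, its one-sided derivative along
  \<open>-h\<close> is attained as an exact difference for all small steps, without error term.
\<close>
lemma exact_descent:
  fixes v h :: "real ^ 'n::finite"
  assumes sym: "transpose a = a" and a0: "\<And>i j. 0 \<le> a $ i $ j"
  obtains J t where "J \<in> calibrations a v" and "t > 0"
    and "total_variation a (v - t *\<^sub>R h) =
      total_variation a v - t * (\<Sum>i\<in>UNIV. \<Sum>j\<in>UNIV. J $ i $ j * (h $ i - h $ j))"
proof -
  define J :: "real ^ 'n ^ 'n" where
    "J = (\<chi> i j. a $ i $ j * (if v $ i = v $ j then - sgn (h $ i - h $ j) else sgn (v $ i - v $ j)))"
  have symm: "a $ i $ j = a $ j $ i" for i j
    using sym by (auto simp: transpose_def vec_eq_iff)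
  have "antisymmetric J"
    unfolding antisymmetric_def J_def using symm by (auto simp: sgn_real_def)
  moreover have "\<bar>J $ i $ j\<bar> \<le> a $ i $ j" for i j
    using a0[of i j] by (auto simp: J_def abs_mult abs_sgn_eq)
  moreover have "J $ i $ j * (v $ i - v $ j) = a $ i $ j * \<bar>v $ i - v $ j\<bar>" for i j
    by (auto simp: J_def sgn_real_def)
  ultimately have J: "J \<in> calibrations a v" by (simp add: calibrations_def)
  \<comment> \<open>A step no longer than these ratios reverses the sign of no difference of \<open>v\<close>;
      the element \<open>1\<close> covers a constant \<open>v\<close>, and the summand \<open>1\<close> covers equal values of \<open>h\<close>.\<close>
  define S where "S = insert 1 ((\<lambda>(i, j). \<bar>v $ i - v $ j\<bar> / (1 + \<bar>h $ i - h $ j\<bar>)) `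
    {(i, j). v $ i \<noteq> v $ j})"
  define t where "t = Min S"
  have fin: "finite S" "S \<noteq> {}" by (auto simp: S_def)
  have t: "t > 0"
    unfolding t_def using fin by (subst Min_gr_iff) (auto simp: S_def)
  have step: "t * \<bar>h $ i - h $ j\<bar> \<le> \<bar>v $ i - v $ j\<bar>" if "v $ i \<noteq> v $ j" for i j
  proof -
    have "t \<le> \<bar>v $ i - v $ j\<bar> / (1 + \<bar>h $ i - h $ j\<bar>)"
      unfolding t_def using fin that by (intro Min_le) (auto simp: S_def)
    then have "t * (1 + \<bar>h $ i - h $ j\<bar>) \<le> \<bar>v $ i - v $ j\<bar>"
      by (simp add: pos_le_divide_eq)
    then show ?thesis using t by (simp add: algebra_simps)
  qed
  have "a $ i $ j * \<bar>(v - t *\<^sub>R h) $ i - (v - t *\<^sub>R h) $ j\<bar> =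
      a $ i $ j * \<bar>v $ i - v $ j\<bar> - t * (J $ i $ j * (h $ i - h $ j))" for i j
  proof -
    define x where "x = v $ i - v $ j"
    define y where "y = h $ i - h $ j"
    have eq: "(v - t *\<^sub>R h) $ i - (v - t *\<^sub>R h) $ j = x - t * y"
      by (simp add: x_def y_def algebra_simps)
    have "\<bar>x - t * y\<bar> = \<bar>x\<bar> - t * ((if x = 0 then - sgn y else sgn x) * y)"
    proof (cases "x = 0")
      case True
      then show ?thesis using t by (simp add: abs_mult abs_sgn_eq sgn_real_def)
    next
      case False
      then have "\<bar>t * y\<bar> \<le> \<bar>x\<bar>"
        using step[of i j] t by (simp add: x_def y_def abs_mult)
      then show ?thesis using False by (auto simp: sgn_real_def)
    qed
    moreover have "J $ i $ j = a $ i $ j * (if x = 0 then - sgn y else sgn x)"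
      by (simp add: J_def x_def y_def)
    ultimately have "a $ i $ j * \<bar>x - t * y\<bar> = a $ i $ j * \<bar>x\<bar> - t * (J $ i $ j * y)"
      by (simp only:) (simp only: right_diff_distrib mult.assoc mult.left_commute)
    then show ?thesis
      unfolding eq by (simp only: x_def y_def)
  qed
  then have "total_variation a (v - t *\<^sub>R h) =
      total_variation a v - t * (\<Sum>i\<in>UNIV. \<Sum>j\<in>UNIV. J $ i $ j * (h $ i - h $ j))"
    by (simp only: total_variation_def sum_subtractf sum_distrib_left)
  with J t show ?thesis by (rule that)
qed

text \<open>
  A calibrating flow conserved at the interior is a zero of the interior divergence on the set of
  all calibrating flows. Compactness makes the set of divergences closed, so that a missing zero
  can be strictly separated from it, and moving \<open>v\<close> against the
  separating normal vector decreases the functional.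
\<close>
lemma minimizer_imp_calibrated:
  fixes v :: "real ^ 'n::finite"
  assumes sym: "transpose a = a" and a0: "\<And>i j. 0 \<le> a $ i $ j"
    and v: "agrees_on_boundary B f v"
    and min: "\<And>u. agrees_on_boundary B f u \<Longrightarrow> total_variation a v \<le> total_variation a u"
  shows "\<exists>J\<in>calibrations a v. conserved_off B J"
proof (rule ccontr)
  assume no: "\<not> ?thesis"
  define D :: "real ^ 'n ^ 'n \<Rightarrow> real ^ 'n" where
    "D J = (\<chi> i. if i \<in> B then 0 else \<Sum>j\<in>UNIV. J $ i $ j)" for J
  have D: "linear D"
    by (rule linearI) (auto simp: D_def vec_eq_iff sum.distrib sum_distrib_left)
  let ?S = "D ` calibrations a v"
  have "convex ?S"
    using D convex_calibrations by (rule convex_linear_image)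
  moreover have "closed ?S"
    using D compact_calibrations
    by (intro compact_imp_closed compact_continuous_image linear_continuous_on)
      (auto simp: linear_conv_bounded_linear)
  moreover have "0 \<notin> ?S"
  proof
    assume "0 \<in> ?S"
    then obtain J where J: "J \<in> calibrations a v" "D J = 0" by auto
    have "conserved_off B J"
      unfolding conserved_off_def
    proof (intro allI impI)
      fix i assume "i \<notin> B"
      moreover have "D J $ i = 0" using J(2) by simp
      ultimately show "(\<Sum>j\<in>UNIV. J $ i $ j) = 0" by (simp add: D_def)
    qed
    with J no show False by blast
  qed
  ultimately obtain g b where b: "0 < b" "\<And>x. x \<in> ?S \<Longrightarrow> b < g \<bullet> x"
    using separating_hyperplane_closed_0[of ?S] by (metis (no_types, lifting))
  \<comment> \<open>The divergences vanish on the boundary, so cutting the normal vector off there does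
      not affect the separation.\<close>
  define h :: "real ^ 'n" where "h = (\<chi> i. if i \<in> B then 0 else g $ i)"
  obtain J t where J: "J \<in> calibrations a v" and t: "t > 0"
    and eq: "total_variation a (v - t *\<^sub>R h) =
      total_variation a v - t * (\<Sum>i\<in>UNIV. \<Sum>j\<in>UNIV. J $ i $ j * (h $ i - h $ j))"
    using exact_descent[OF sym a0] by blast
  have "0 < g \<bullet> D J" using b J by force
  also have "g \<bullet> D J = (\<Sum>i\<in>UNIV. h $ i * (\<Sum>j\<in>UNIV. J $ i $ j))"
    unfolding inner_vec_def by (intro sum.cong) (auto simp: D_def h_def)
  finally have "0 < (\<Sum>i\<in>UNIV. \<Sum>j\<in>UNIV. J $ i $ j * (h $ i - h $ j))"
    using J by (simp add: calibrations_def sum_by_parts)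
  then have "total_variation a (v - t *\<^sub>R h) < total_variation a v"
    unfolding eq using t by simp
  moreover have "agrees_on_boundary B f (v - t *\<^sub>R h)"
    using v by (simp add: agrees_on_boundary_def h_def)
  ultimately show False using min by fastforce
qed

theorem theorem2p10:
  fixes E :: "'n::finite set set"
    and B :: "'n set"
    and f :: "'n \<Rightarrow> real"
    and a :: "real ^ 'n ^ 'n"
    and v :: "real ^ 'n"
  assumes "simple_graph E"
    and "connected_graph E"
    and "B \<noteq> {}"
    and "measurement_matrix E a"
  shows "v \<in> voltage_potentials E B f a \<longleftrightarrow>
    is_arg_min (\<lambda>u. 1 / 2 * (\<Sum>i\<in>UNIV. \<Sum>j\<in>UNIV. a $ i $ j * \<bar>u $ i - u $ j\<bar>))
      (agrees_on_boundary B f) v"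
proof -
  have a: "transpose a = a" "\<And>i j. 0 \<le> a $ i $ j"
    using assms(4) by (auto simp: measurement_matrix_def)
  have "is_arg_min (\<lambda>u. 1 / 2 * (\<Sum>i\<in>UNIV. \<Sum>j\<in>UNIV. a $ i $ j * \<bar>u $ i - u $ j\<bar>))
      (agrees_on_boundary B f) v \<longleftrightarrow> agrees_on_boundary B f v \<and>
      (\<forall>u. agrees_on_boundary B f u \<longrightarrow> total_variation a v \<le> total_variation a u)"
    by (auto simp: is_arg_min_linorder total_variation_def)
  also have "\<dots> \<longleftrightarrow> agrees_on_boundary B f v \<and> (\<exists>J\<in>calibrations a v. conserved_off B J)"
    using minimizer_imp_calibrated[OF a] calibrated_imp_minimizer by metis
  finally show ?thesis
    by (simp only: voltage_potentials_iff_calibrated[OF assms(4)])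
qed

end
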